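(* The set $\mathit{TpcN}$ of typical numbers in $[0,1]$ is a Borel set and it is $\Pi^0_3([0,1])$-complete, i.e. $\mathit{TpcN}\in\Pi^0_3([0,1])\setminus\Sigma^0_3([0,1])$.
   Context: For $x=(x_1,x_2,\dots)\in\{0,1\}^{\mathbb N}$ and $n\ge 1$ let $L_n(x)=\max\{j\ge 0: x_{i+1}=\dots=x_{i+j}=1 \text{ for some } 0\le i\le n-j\}$, the length of the longest run of consecutive ones among the first $n$ digits. A number $y\in[0,1]$ is identified with its binary expansion $x$, where $y=\sum_{n\ge1}x_n2^{-n}$. A number with two binary expansions satisfies the defining condition below for neither of them, so it is not typical. A number $y\in[0,1]$ is called typical if its binary expansion $x$ satisfies $\lim_{n\to\infty}\frac{L_n(x)}{\log_2 n}=1$. $\mathit{TpcN}$ denotes the set of typical numbers. Borel hierarchy: $\Sigma^0_1$ is the class of open sets and $\Pi^0_1$ the class of closed sets. $\Sigma^0_{k}$ consists of countable unions of complements of sets from lower $\Pi$-levels, and $\Pi^0_k$ consists of complements of $\Sigma^0_k$ sets. A set is called $\Pi^0_3$-complete if it belongs to $\Pi^0_3$ but not to $\Sigma^0_3$. *)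

theory Defs
  imports "HOL-Analysis.Analysis"
begin

text \<open>
  Finite levels of the Borel hierarchy of a topological space \<open>X\<close>, indexed from 1
  (there are no sets at level 0). All sets are subsets of \<open>topspace X\<close>, and complements are
  taken in \<open>topspace X\<close>.
\<close>

inductive Sigma0 :: "'a topology \<Rightarrow> nat \<Rightarrow> 'a set \<Rightarrow> bool"
  and Pi0 :: "'a topology \<Rightarrow> nat \<Rightarrow> 'a set \<Rightarrow> bool"
  for X :: "'a topology" where
  Sigma0_open: "openin X U \<Longrightarrow> Sigma0 X 1 U"
| Sigma0_Union: "(\<And>n::nat. 1 \<le> j n \<and> j n < k \<and> Pi0 X (j n) (A n)) \<Longrightarrow> Sigma0 X k (\<Union>n. A n)"
| Pi0_compl: "Sigma0 X k U \<Longrightarrow> Pi0 X k (topspace X - U)"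

definition Pi0_3_complete :: "'a topology \<Rightarrow> 'a set \<Rightarrow> bool" where
  "Pi0_3_complete X S \<longleftrightarrow> Pi0 X 3 S \<and> \<not> Sigma0 X 3 S"

text \<open>
  Digit sequences are indexed from 0, so \<open>x n\<close> is the digit usually written \<open>x\<^sub>n\<^sub>+\<^sub>1\<close>,
  of weight \<open>2\<^sup>-\<^sup>(\<^sup>n\<^sup>+\<^sup>1\<^sup>)\<close>, and the first \<open>n\<close> digits are \<open>x 0, \<dots>, x (n - 1)\<close>.
\<close>

definition binary_expansion :: "(nat \<Rightarrow> nat) \<Rightarrow> real \<Rightarrow> bool" where
  "binary_expansion x y \<longleftrightarrow> (\<forall>n. x n \<in> {0, 1}) \<and> (\<lambda>n. real (x n) / 2 ^ Suc n) sums y"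

text \<open>The set below contains 0 and is bounded by \<open>n\<close>, so the maximum is attained.\<close>

definition longest_run :: "nat \<Rightarrow> (nat \<Rightarrow> nat) \<Rightarrow> nat" where
  "longest_run n x = Max {j. \<exists>i. i + j \<le> n \<and> (\<forall>k<j. x (i + k) = 1)}"

text \<open>
  A number with two expansions (one ending in zeros, one in ones) satisfies the limit condition
  for neither, so quantifying existentially over the expansions involves no choice.
\<close>

definition typical :: "real \<Rightarrow> bool" where
  "typical y \<longleftrightarrow>
     (\<exists>x. binary_expansion x y \<and> (\<lambda>n. real (longest_run n x) / log 2 (real n)) \<longlonglongrightarrow> 1)"

definition TpcN :: "real set" where
  "TpcN = {y \<in> {0..1}. typical y}"

end

theory Submission
  imports Defs
begin

text \<open>
  Upper bound: off the rationals the first \<open>n\<close> binary digits, hence \<open>L\<^sub>n / log\<^sub>2 n\<close>, are locally constant,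
  and the set of points where a sequence of functions, continuous off a countable set, converges to a
  given value is \<open>\<Pi>\<^sup>0\<^sub>3\<close>.

  Lower bound: code \<open>a \<in> \<nat>\<^sup>\<nat>\<close> by the number whose digits between \<open>2\<^sup>k\<close> and \<open>2\<^sup>k\<^sup>+\<^sup>1\<close> contain one run of
  \<open>k + k div (a\<^sub>k + 1)\<close> ones. The code is continuous, and it is typical iff \<open>a\<^sub>k\<close> tends to infinity. If the
  set of sequences tending to infinity were a union of \<open>G\<^sub>\<delta>\<close> sets \<open>G\<^sub>0, G\<^sub>1, \<dots>\<close>, then by a Baire category
  argument each \<open>G\<^sub>n\<close> could be avoided by fixing a longer initial segment while keeping all later entries
  \<open>\<ge> n\<close>. Iterating gives a sequence that tends to infinity and lies in no \<open>G\<^sub>n\<close>.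
\<close>

subsection \<open>Sequences tending to infinity\<close>

definition cylinder :: "(nat \<Rightarrow> 'a) \<Rightarrow> nat \<Rightarrow> (nat \<Rightarrow> 'a) set" where
  "cylinder a N = {b. \<forall>i<N. b i = a i}"

text \<open>A closed set of sequences. Passing to longer prefixes with larger \<open>m\<close>
  forces the limit sequence to tend to infinity.\<close>

definition cylinder_ge :: "(nat \<Rightarrow> nat) \<Rightarrow> nat \<Rightarrow> nat \<Rightarrow> (nat \<Rightarrow> nat) set" where
  "cylinder_ge a N m = {b \<in> cylinder a N. \<forall>i\<ge>N. m \<le> b i}"

definition cylinder_open :: "(nat \<Rightarrow> 'a) set \<Rightarrow> bool" where
  "cylinder_open U \<longleftrightarrow> (\<forall>a\<in>U. \<exists>N. cylinder a N \<subseteq> U)"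

text \<open>Completeness of Baire space: prefixes that extend one another have a common extension.
  Entry \<open>i\<close> is settled by stage \<open>Suc i\<close>, because
  \<open>i < N (Suc i)\<close>, so the limit is read off the diagonal.\<close>

lemma coherent_cylinders_limit:
  fixes b :: "nat \<Rightarrow> nat \<Rightarrow> 'a"
  assumes N: "strict_mono N" and step: "\<And>n. b (Suc n) \<in> cylinder (b n) (N n)"
  obtains y where "\<And>n. y \<in> cylinder (b n) (N n)"
proof -
  have agree: "b k i = b n i" if "n \<le> k" "i < N n" for n k i
    using that(1)
  proof (induction k rule: dec_induct)
    case (step k)
    have "i < N k"
      using that(2) strict_mono_less_eq[OF N] step(1) by (meson less_le_trans)
    then show ?case
      using assms(2)[of k] step by (simp add: cylinder_def)
  qed simp
  have "b (Suc i) i = b n i" if "i < N n" for i n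
  proof (cases "n \<le> Suc i")
    case True
    then show ?thesis using agree that by blast
  next
    case False
    have "i < N (Suc i)"
      using strict_mono_imp_increasing[OF N, of "Suc i"] by simp
    then show ?thesis
      using agree[of "Suc i" n i] False by simp
  qed
  then show thesis
    by (intro that[of "\<lambda>i. b (Suc i) i"]) (auto simp: cylinder_def)
qed

lemma cylinder_ge_trans: "b \<in> cylinder_ge a N m \<Longrightarrow> N \<le> N' \<Longrightarrow> c \<in> cylinder_ge b N' m \<Longrightarrow> c \<in> cylinder_ge a N m"
  unfolding cylinder_ge_def cylinder_def
  by (auto, metis linorder_not_less)

text \<open>A Baire category argument in the closed set \<open>cylinder_ge a N m\<close>, where attaining the value
  \<open>m\<close> infinitely often is a dense \<open>G\<^sub>\<delta>\<close> condition that contradicts divergence to infinity.\<close>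

lemma cylinder_ge_avoiding_gdelta:
  fixes U :: "nat \<Rightarrow> (nat \<Rightarrow> nat) set"
  assumes U: "\<And>n. cylinder_open (U n)"
    and sub: "\<And>y. y \<in> (\<Inter>n. U n) \<Longrightarrow> filterlim y at_top sequentially"
  obtains b N' where "b \<in> cylinder_ge a N m" "N < N'" "cylinder_ge b N' m \<inter> (\<Inter>n. U n) = {}"
proof (rule ccontr)
  note avoid = that
  assume "\<not> thesis"
  then have dense: "\<exists>y. y \<in> cylinder_ge b N' m \<and> (\<forall>n. y \<in> U n)"
    if "b \<in> cylinder_ge a N m" "N < N'" for b N'
    using avoid[OF that] by auto
  define P where "P = (\<lambda>(n::nat) (b, N'). b \<in> cylinder_ge a N m \<and> N \<le> N')"
  \<comment> \<open>A state is a sequence of which the first \<open>N'\<close> entries count. Each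
    step extends this prefix, plants the value \<open>m\<close> at position \<open>N'\<close> and
    makes the new cylinder lie in the next open set.\<close>
  define Q where "Q = (\<lambda>n (b, N') (c, N''). c \<in> cylinder b N' \<and> N' < N'' \<and> c N' = m \<and> cylinder c N'' \<subseteq> U n)"
  have "\<exists>f. \<forall>n. P n (f n) \<and> Q n (f n) (f (Suc n))"
  proof (rule dependent_nat_choice)
    have "P 0 (\<lambda>i. if i < N then a i else m, N)"
      by (auto simp: P_def cylinder_ge_def cylinder_def)
    then show "\<exists>x. P 0 x" by blast
  next
    fix p n assume "P n p"
    then obtain b N' where p: "p = (b, N')" and b: "b \<in> cylinder_ge a N m" "N \<le> N'"
      by (cases p) (auto simp: P_def)
    define c where "c = b(N' := m)"
    have c: "c \<in> cylinder_ge a N m"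
      using b by (auto simp: c_def cylinder_ge_def cylinder_def)
    obtain y where y: "y \<in> cylinder_ge c (Suc N') m" "\<And>n. y \<in> U n"
      using dense[OF c, of "Suc N'"] b by auto
    obtain K where K: "cylinder y K \<subseteq> U n"
      using U y(2) unfolding cylinder_open_def by blast
    have "P (Suc n) (y, max K (Suc N'))"
      using cylinder_ge_trans[OF c _ y(1)] b by (auto simp: P_def)
    moreover have "Q n p (y, max K (Suc N'))"
      using y(1) K unfolding Q_def p by (auto simp: cylinder_ge_def cylinder_def c_def)
    ultimately show "\<exists>q. P (Suc n) q \<and> Q n p q" by blast
  qed
  then obtain f where f: "\<And>n. Q n (f n) (f (Suc n))" by blast
  define c where "c = fst \<circ> f"
  define M where "M = snd \<circ> f"
  have Q: "c (Suc n) \<in> cylinder (c n) (M n)" "M n < M (Suc n)" "c (Suc n) (M n) = m"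
    "cylinder (c (Suc n)) (M (Suc n)) \<subseteq> U n" for n
    using f[of n] by (auto simp: Q_def c_def M_def split: prod.splits)
  have M: "strict_mono M" by (simp add: strict_mono_Suc_iff Q)
  obtain y where y: "\<And>n. y \<in> cylinder (c n) (M n)"
    using coherent_cylinders_limit[OF M Q(1)] by blast
  have "y \<in> U n" for n using y[of "Suc n"] Q(4) by blast
  then have "eventually (\<lambda>i. Suc m \<le> y i) sequentially"
    using sub[of y] unfolding filterlim_at_top by blast
  then obtain n where n: "\<And>i. n \<le> i \<Longrightarrow> Suc m \<le> y i"
    unfolding eventually_sequentially by blast
  have "y (M n) = m"
    using y[of "Suc n"] Q(2,3)[of n] by (simp add: cylinder_def)
  then show False
    using n[of "M n"] strict_mono_imp_increasing[OF M, of n] by simp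
qed

proposition diverging_sequences_not_gdelta_sigma:
  fixes U :: "nat \<Rightarrow> nat \<Rightarrow> (nat \<Rightarrow> nat) set"
  assumes U: "\<And>n k. cylinder_open (U n k)"
  shows "(\<Union>n. \<Inter>k. U n k) \<noteq> {y. filterlim y at_top sequentially}"
proof
  assume eq: "(\<Union>n. \<Inter>k. U n k) = {y. filterlim y at_top sequentially}"
  define Q where "Q = (\<lambda>n (b, N) (c, N'). c \<in> cylinder_ge b N n \<and> N < N' \<and>
    cylinder_ge c N' n \<inter> (\<Inter>k. U n k) = {})"
  have "\<exists>f. \<forall>n. True \<and> Q n (f n) (f (Suc n))"
  proof (rule dependent_nat_choice)
    fix p :: "(nat \<Rightarrow> nat) \<times> nat" and n
    obtain b N where p: "p = (b, N)" by (cases p)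
    obtain c N' where "c \<in> cylinder_ge b N n" "N < N'" "cylinder_ge c N' n \<inter> (\<Inter>k. U n k) = {}"
    proof (rule cylinder_ge_avoiding_gdelta[of "U n" b N n])
      show "filterlim y at_top sequentially" if "y \<in> (\<Inter>k. U n k)" for y
        using that eq by blast
    qed (rule U)
    then have "Q n p (c, N')" by (simp add: Q_def p)
    then show "\<exists>q. True \<and> Q n p q" by blast
  qed simp
  then obtain f where f: "\<And>n. Q n (f n) (f (Suc n))" by blast
  define c where "c = fst \<circ> f"
  define M where "M = snd \<circ> f"
  have Q: "c (Suc n) \<in> cylinder_ge (c n) (M n) n" "M n < M (Suc n)"
    "cylinder_ge (c (Suc n)) (M (Suc n)) n \<inter> (\<Inter>k. U n k) = {}" for n
    using f[of n] by (auto simp: Q_def c_def M_def split: prod.splits)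
  have M: "strict_mono M" by (simp add: strict_mono_Suc_iff Q)
  obtain y where y: "\<And>n. y \<in> cylinder (c n) (M n)"
    using coherent_cylinders_limit[OF M, of c] Q(1) unfolding cylinder_ge_def by blast
  have ge: "n \<le> y i" if "M n \<le> i" for n i
  proof -
    \<comment> \<open>The first stage whose prefix contains position \<open>i\<close>. The step that
      lengthened the prefix past \<open>i\<close>, from stage \<open>l\<close> to
      \<open>Suc l\<close>, kept all new entries at least \<open>l\<close>.\<close>
    define k where "k = (LEAST k. i < M k)"
    have "i < M (Suc i)" using strict_mono_imp_increasing[OF M, of "Suc i"] by simp
    then have k: "i < M k" unfolding k_def by (rule LeastI)
    have "n < k" using k that strict_mono_less[OF M] by (meson le_less_trans)
    then obtain l where l: "k = Suc l" "n \<le> l" by (cases k) auto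
    have "M l \<le> i" using not_less_Least[of l "\<lambda>k. i < M k"] l unfolding k_def by simp
    then have "l \<le> c k i" using Q(1)[of l] l by (auto simp: cylinder_ge_def)
    moreover have "y i = c k i" using y[of k] k by (simp add: cylinder_def)
    ultimately show ?thesis using l by simp
  qed
  have "filterlim y at_top sequentially"
    unfolding filterlim_at_top eventually_sequentially using ge by blast
  then obtain n where "y \<in> (\<Inter>k. U n k)" using eq by blast
  moreover have "y \<in> cylinder_ge (c (Suc n)) (M (Suc n)) n"
    using y[of "Suc n"] ge[of "Suc n"] by (auto simp: cylinder_ge_def Suc_le_eq less_imp_le)
  ultimately show False using Q(3) by blast
qed

subsection \<open>The Borel hierarchy\<close>

text \<open>The union rule cannot yield level 1, since it would need a level \<open>j\<close> with
  \<open>1 \<le> j < 1\<close>.\<close>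

lemma Sigma0_1_iff: "Sigma0 X 1 S \<longleftrightarrow> openin X S"
proof
  have "openin X S" if "Sigma0 X k S" "k = 1" for k
    using that
  proof cases
    case (Sigma0_Union j A)
    then show ?thesis using Sigma0_Union(2)[of 0] that(2) by linarith
  qed simp
  then show "Sigma0 X 1 S \<Longrightarrow> openin X S" by blast
qed (rule Sigma0_open)

lemma Pi0_iff: "Pi0 X k S \<longleftrightarrow> (\<exists>U. Sigma0 X k U \<and> S = topspace X - U)"
  by (auto intro: Pi0_compl elim: Pi0.cases)

lemma Pi0_1_iff: "Pi0 X 1 S \<longleftrightarrow> closedin X S"
  unfolding Pi0_iff Sigma0_1_iff
  by (metis closedin_def double_diff openin_closedin_eq openin_diff openin_topspace closedin_subset order_refl)

lemma Sigma0_Union_cases: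
  assumes "Sigma0 X k S" "1 < k"
  obtains A j where "S = (\<Union>n. A n)"
     "\<And>n::nat. 1 \<le> j n \<and> j n < k \<and> Pi0 X (j n) (A n)"
  using assms by cases auto

lemma Sigma0_2_imp_fsigma_in:
  assumes "Sigma0 X 2 S"
  shows "fsigma_in X S"
proof -
  obtain A j where S: "S = (\<Union>n. A n)" and A: "\<And>n::nat. 1 \<le> j n \<and> j n < 2 \<and> Pi0 X (j n) (A n)"
    using Sigma0_Union_cases[OF assms] by auto
  have "j n = 1" for n using A[of n] by linarith
  then have "closedin X (A n)" for n using A[of n] Pi0_1_iff by metis
  then show ?thesis
    unfolding S by (intro fsigma_in_Union) (auto intro: closed_imp_fsigma_in)
qed

lemma Pi0_2_imp_gdelta_in: "Pi0 X 2 S \<Longrightarrow> gdelta_in X S"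
  unfolding Pi0_iff using Sigma0_2_imp_fsigma_in
  by (metis Diff_subset fsigma_in_gdelta_in double_diff fsigma_in_subset order_refl)

text \<open>The members of the union have level 1 or 2. In a metrizable space closed sets are
  \<open>G_delta\<close>, so both levels are treated alike.\<close>

lemma Sigma0_3_gdelta_sigma:
  assumes "metrizable_space X" "Sigma0 X 3 S"
  obtains G where "\<And>n::nat. gdelta_in X (G n)" "S = (\<Union>n. G n)"
proof -
  obtain A j where S: "S = (\<Union>n. A n)" and A: "\<And>n::nat. 1 \<le> j n \<and> j n < 3 \<and> Pi0 X (j n) (A n)"
    using Sigma0_Union_cases[OF assms(2)] by auto
  have "gdelta_in X (A n)" for n
  proof (cases "j n = 1")
    case True
    then show ?thesis using A[of n] Pi0_1_iff closed_imp_gdelta_in assms(1) by metis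
  next
    case False
    then have "j n = 2" using A[of n] by linarith
    then show ?thesis using A[of n] Pi0_2_imp_gdelta_in by metis
  qed
  then show thesis using that S by blast
qed

lemma Sigma0_countable_Union:
  assumes "countable C" "C \<noteq> {}" "\<And>A. A \<in> C \<Longrightarrow> \<exists>j. 1 \<le> j \<and> j < k \<and> Pi0 X j A"
  shows "Sigma0 X k (\<Union>C)"
proof -
  have "\<exists>j. 1 \<le> j \<and> j < k \<and> Pi0 X j (from_nat_into C n)" for n
    using assms from_nat_into by metis
  then obtain j where "\<And>n. 1 \<le> j n \<and> j n < k \<and> Pi0 X (j n) (from_nat_into C n)"
    by metis
  then have "Sigma0 X k (\<Union>n. from_nat_into C n)" by (rule Sigma0_Union)
  then show ?thesis using range_from_nat_into[OF assms(2,1)] by simp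
qed

lemma Borel_hierarchy_sets_restrict_borel:
  shows "Sigma0 (top_of_set S) k A \<Longrightarrow> A \<in> sets (restrict_space borel S)"
    and "Pi0 (top_of_set S) k A \<Longrightarrow> A \<in> sets (restrict_space borel S)"
proof (induction rule: Sigma0_Pi0.inducts)
  case (Sigma0_open U)
  then obtain T where "open T" "U = S \<inter> T" by (auto simp: openin_open)
  then show ?case unfolding sets_restrict_space by (intro image_eqI[of _ _ T]) auto
next
  case (Pi0_compl k U)
  then show ?case
    using sets.compl_sets[of U "restrict_space borel S"] by (simp add: space_restrict_space)
next
  case (Sigma0_Union j k A)
  then have "A n \<in> sets (restrict_space borel S)" for n by blast
  then show ?case by (intro sets.countable_UN) auto
qed

text \<open>Off \<open>D\<close>, the set where \<open>f n\<close> is \<open>\<epsilon>\<close>-close to \<open>l\<close> may be replaced by its closure, so being eventually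
  \<open>\<epsilon>\<close>-close is an \<open>F\<^sub>\<sigma>\<close> condition there. The countably many exceptions in \<open>D\<close> are removed point by point.\<close>

lemma Pi0_3_convergence_set:
  fixes f :: "nat \<Rightarrow> 'a::t2_space \<Rightarrow> 'b::metric_space"
  assumes D: "countable D" and cont: "\<And>n y. y \<in> S - D \<Longrightarrow> isCont (f n) y"
  shows "Pi0 (top_of_set S) 3 {y \<in> S. (\<lambda>n. f n y) \<longlonglongrightarrow> l}"
proof -
  define T where "T = {y \<in> S. (\<lambda>n. f n y) \<longlonglongrightarrow> l}"
  define A where "A k n = {y. dist (f n y) l \<le> inverse (real (Suc k))}" for k n
  define C where "C k N = S \<inter> (\<Inter>n\<in>{N..}. closure (A k n))" for k N
  define W where "W k = S - (\<Union>N. C k N)" for k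
  have "closedin (top_of_set S) (C k N)" for k N
    unfolding C_def by (intro closedin_closed_Int closed_INT) simp
  then have "Sigma0 (top_of_set S) 2 (\<Union>N. C k N)" for k
    using Sigma0_Union[of "\<lambda>_. 1" 2 "top_of_set S" "C k"] by (simp add: Pi0_1_iff[simplified])
  then have W: "Pi0 (top_of_set S) 2 (W k)" for k
    using Pi0_compl unfolding W_def by fastforce
  have point: "Pi0 (top_of_set S) 1 {d}" if "d \<in> S" for d
    unfolding Pi0_1_iff using that by (intro closed_subset) auto
  \<comment> \<open>Taking closures only enlarges \<open>C k N\<close>, so this holds at every
    point, those of \<open>D\<close> included.\<close>
  have sub: "W k \<inter> T = {}" for k
  proof -
    have "y \<in> (\<Union>N. C k N)" if "y \<in> T" for y
    proof -
      have "\<forall>\<^sub>F n in sequentially. dist (f n y) l < inverse (real (Suc k))"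
        using that unfolding T_def by (intro tendstoD) auto
      then obtain N where "\<And>n. N \<le> n \<Longrightarrow> y \<in> A k n"
        unfolding eventually_sequentially A_def by (auto intro: less_imp_le)
      then have "y \<in> C k N"
        using that closure_subset unfolding C_def T_def by fastforce
      then show ?thesis by blast
    qed
    then show ?thesis unfolding W_def by blast
  qed
  have sup: "\<exists>k. y \<in> W k" if "y \<in> S" "y \<notin> T" "y \<notin> D" for y
  proof -
    have "\<not> (\<lambda>n. f n y) \<longlonglongrightarrow> l" using that by (simp add: T_def)
    then obtain e where e: "0 < e" "\<And>N. \<exists>n\<ge>N. e \<le> dist (f n y) l"
      unfolding lim_sequentially by (metis linorder_not_less)
    obtain k where k: "inverse (real (Suc k)) < e" using reals_Archimedean e(1) by blast
    have "y \<notin> C k N" for N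
    proof -
      obtain n where n: "N \<le> n" "e \<le> dist (f n y) l" using e by blast
      \<comment> \<open>As \<open>f n y\<close> is at distance at least \<open>e\<close> from
        \<open>l\<close>, continuity keeps a whole neighbourhood of \<open>y\<close> disjoint from
        \<open>A k n\<close>, so \<open>y\<close> is not in its closure.\<close>
      have "(f n \<longlongrightarrow> f n y) (nhds y)"
        using cont[of y n] that by (simp add: continuous_within tendsto_at_iff_tendsto_nhds)
      then have "((\<lambda>z. dist (f n z) l) \<longlongrightarrow> dist (f n y) l) (nhds y)"
        by (intro tendsto_dist tendsto_const)
      then have "\<forall>\<^sub>F z in nhds y. inverse (real (Suc k)) < dist (f n z) l"
        by (rule order_tendstoD(1)) (use k n in linarith)
      then obtain B where "open B" "y \<in> B" "\<And>z. z \<in> B \<Longrightarrow> z \<notin> A k n"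
        unfolding eventually_nhds A_def mem_Collect_eq not_le by blast
      then have "y \<notin> closure (A k n)"
        using open_Int_closure_eq_empty[of B "A k n"] by blast
      then show ?thesis using n unfolding C_def by blast
    qed
    then show ?thesis using that by (auto simp: W_def)
  qed
  have "Sigma0 (top_of_set S) 3 (\<Union>((\<lambda>d. {d}) ` (D \<inter> S - T) \<union> range W))"
  proof (rule Sigma0_countable_Union)
    fix B assume "B \<in> (\<lambda>d. {d}) ` (D \<inter> S - T) \<union> range W"
    then show "\<exists>j\<ge>1. j < 3 \<and> Pi0 (top_of_set S) j B"
    proof
      assume "B \<in> (\<lambda>d. {d}) ` (D \<inter> S - T)"
      then have "Pi0 (top_of_set S) 1 B" using point by blast
      then show ?thesis by (intro exI[of _ 1]) simp
    next
      assume "B \<in> range W"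
      then have "Pi0 (top_of_set S) 2 B" using W by blast
      then show ?thesis by (intro exI[of _ 2]) simp
    qed
  qed (use D in auto)
  also have "\<Union>((\<lambda>d. {d}) ` (D \<inter> S - T) \<union> range W) = S - T"
  proof (intro equalityI subsetI)
    fix y assume "y \<in> \<Union>((\<lambda>d. {d}) ` (D \<inter> S - T) \<union> range W)"
    then show "y \<in> S - T" using sub by (auto simp: W_def)
  next
    fix y assume "y \<in> S - T"
    then show "y \<in> \<Union>((\<lambda>d. {d}) ` (D \<inter> S - T) \<union> range W)"
      using sup[of y] by (cases "y \<in> D") auto
  qed
  finally have "Pi0 (top_of_set S) 3 (S - (S - T))" using Pi0_compl by fastforce
  moreover have "S - (S - T) = T" by (auto simp: T_def)
  ultimately show ?thesis by (simp add: T_def)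
qed

subsection \<open>Binary digits and runs\<close>

lemma finite_run_lengths: "finite {j. \<exists>i. i + j \<le> n \<and> (\<forall>k<j. x (i + k) = 1)}"
  for n :: nat
  by (rule finite_subset[OF _ finite_atMost[of n]]) auto

lemma longest_run_ge:
  assumes "i + j \<le> n" "\<And>k. k < j \<Longrightarrow> x (i + k) = 1"
  shows "j \<le> longest_run n x"
  unfolding longest_run_def by (rule Max_ge[OF finite_run_lengths]) (use assms in blast)

lemma longest_run_le:
  assumes "\<And>i j. i + j \<le> n \<Longrightarrow> (\<And>k. k < j \<Longrightarrow> x (i + k) = 1) \<Longrightarrow> j \<le> M"
  shows "longest_run n x \<le> M"
  unfolding longest_run_def
proof (rule Max.boundedI[OF finite_run_lengths])
  have "0 \<in> {j. \<exists>i. i + j \<le> n \<and> (\<forall>k<j. x (i + k) = 1)}" by (auto intro: exI[of _ 0])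
  then show "{j. \<exists>i. i + j \<le> n \<and> (\<forall>k<j. x (i + k) = 1)} \<noteq> {}" by blast
qed (use assms in blast)

lemma longest_run_cong:
  assumes "\<And>i. i < n \<Longrightarrow> x i = y i"
  shows "longest_run n x = longest_run n y"
proof -
  have "i + j \<le> n \<and> (\<forall>k<j. x (i + k) = 1) \<longleftrightarrow> i + j \<le> n \<and> (\<forall>k<j. y (i + k) = 1)" for i j
    using assms by auto
  then show ?thesis unfolding longest_run_def by simp
qed

text \<open>With only ones from \<open>N\<close> on, the longest run is at least
  \<open>n - N\<close>. A finite limit of the ratio makes it of order \<open>log n\<close>, hence
  \<open>o(n)\<close>.\<close>

lemma infinitely_many_zeros:
  assumes x: "\<And>n. x n \<in> {0, 1}"
    and lim: "(\<lambda>n. real (longest_run n x) / log 2 (real n)) \<longlonglongrightarrow> l"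
  shows "\<exists>i\<ge>N. x i = 0"
proof (rule ccontr)
  assume "\<not> (\<exists>i\<ge>N. x i = 0)"
  then have one: "x i = 1" if "N \<le> i" for i using x[of i] that by auto
  have "(\<lambda>n. (real (longest_run n x) / log 2 (real n)) * (ln (real n) / real n) / ln 2) \<longlonglongrightarrow> l * 0 / ln 2"
    by (intro tendsto_divide tendsto_mult lim lim_ln_over_n tendsto_const) simp
  moreover have "\<forall>\<^sub>F n in sequentially. (real (longest_run n x) / log 2 (real n)) * (ln (real n) / real n) / ln 2
      = real (longest_run n x) / real n"
    using eventually_ge_at_top[of 2] by eventually_elim (simp add: log_def)
  ultimately have "(\<lambda>n. real (longest_run n x) / real n) \<longlonglongrightarrow> 0"
    using tendsto_cong by fastforce
  moreover have "\<forall>\<^sub>F n in sequentially. 1 - real N / real n \<le> real (longest_run n x) / real n"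
    using eventually_ge_at_top[of "Suc N"]
  proof eventually_elim
    case (elim n)
    have "n - N \<le> longest_run n x"
      by (rule longest_run_ge[of N]) (use elim one in auto)
    then have "real n - real N \<le> real (longest_run n x)" by linarith
    then have "(real n - real N) / real n \<le> real (longest_run n x) / real n"
      by (rule divide_right_mono) simp
    then show ?case using elim by (simp add: diff_divide_distrib)
  qed
  moreover have "(\<lambda>n. 1 - real N / real n) \<longlonglongrightarrow> 1 - 0"
    by (intro tendsto_diff tendsto_const lim_const_over_n)
  ultimately have "(1 - 0 :: real) \<le> 0"
    using tendsto_le[OF sequentially_bot] by blast
  then show False by simp
qed

section \<open>Binary digits through the floor function\<close>

definition bin_digit :: "real \<Rightarrow> nat \<Rightarrow> nat" where
  "bin_digit y n = nat (\<lfloor>2 ^ Suc n * y\<rfloor> mod 2)"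

lemma bin_digit_01: "bin_digit y n \<in> {0, 1}"
  unfolding bin_digit_def by (auto simp: nat_eq_iff2)

text \<open>Partial sums are truncations: halving \<open>\<lfloor>2 ^ Suc n * y\<rfloor>\<close>
  gives \<open>\<lfloor>2 ^ n * y\<rfloor>\<close> with remainder the next digit.\<close>

lemma sum_bin_digit:
  assumes "0 \<le> y" "y < 1"
  shows "(\<Sum>i<n. real (bin_digit y i) / 2 ^ Suc i) = \<lfloor>2 ^ n * y\<rfloor> / 2 ^ n"
proof (induction n)
  case 0
  have "\<lfloor>y\<rfloor> = 0" using assms by (simp add: floor_eq_iff)
  then show ?case by simp
next
  case (Suc n)
  have "\<lfloor>2 ^ n * y\<rfloor> = \<lfloor>2 ^ Suc n * y\<rfloor> div 2"
    using floor_divide_real_eq_div[of 2 "2 ^ Suc n * y"] by simp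
  then have "\<lfloor>2 ^ Suc n * y\<rfloor> = 2 * \<lfloor>2 ^ n * y\<rfloor> + int (bin_digit y n)"
    by (simp add: bin_digit_def)
  then have "real_of_int \<lfloor>2 ^ Suc n * y\<rfloor> = 2 * real_of_int \<lfloor>2 ^ n * y\<rfloor> + real (bin_digit y n)"
    by simp
  then show ?case using Suc by (simp add: field_simps)
qed

lemma binary_expansion_bin_digit:
  assumes "0 \<le> y" "y < 1"
  shows "binary_expansion (bin_digit y) y"
proof -
  have "(\<lambda>n. \<lfloor>2 ^ n * y\<rfloor> / 2 ^ n) \<longlonglongrightarrow> y"
  proof (rule tendsto_sandwich)
    have "(\<lambda>n. y - (1/2) ^ n) \<longlonglongrightarrow> y - 0"
      by (intro tendsto_diff tendsto_const LIMSEQ_power_zero) simp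
    then show "(\<lambda>n. y - (1/2) ^ n) \<longlonglongrightarrow> y" by simp
    have "y - (1/2) ^ n \<le> \<lfloor>2 ^ n * y\<rfloor> / 2 ^ n" for n
    proof -
      have "2 ^ n * y - 1 \<le> \<lfloor>2 ^ n * y\<rfloor>" by linarith
      then have "(2 ^ n * y - 1) / 2 ^ n \<le> \<lfloor>2 ^ n * y\<rfloor> / 2 ^ n" by (rule divide_right_mono) simp
      then show ?thesis by (simp add: diff_divide_distrib power_divide)
    qed
    then show "\<forall>\<^sub>F n in sequentially. y - (1/2) ^ n \<le> \<lfloor>2 ^ n * y\<rfloor> / 2 ^ n" by simp
    show "\<forall>\<^sub>F n in sequentially. \<lfloor>2 ^ n * y\<rfloor> / 2 ^ n \<le> y"
      by (simp add: divide_le_eq mult.commute)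
  qed simp
  then show ?thesis
    using bin_digit_01 sum_bin_digit[OF assms] by (simp add: binary_expansion_def sums_def)
qed

lemma bin_digit_agree_dist:
  assumes "0 \<le> y" "y < 1" "0 \<le> z" "z < 1" "\<And>i. i < n \<Longrightarrow> bin_digit y i = bin_digit z i"
  shows "\<bar>y - z\<bar> < 1 / 2 ^ n"
proof -
  have "\<lfloor>2 ^ n * y\<rfloor> / 2 ^ n = (\<lfloor>2 ^ n * z\<rfloor> / 2 ^ n :: real)"
    using sum_bin_digit[OF assms(1,2), of n] sum_bin_digit[OF assms(3,4), of n] assms(5) by simp
  then have "\<lfloor>2 ^ n * y\<rfloor> = \<lfloor>2 ^ n * z\<rfloor>" by simp
  then have "\<bar>2 ^ n * y - 2 ^ n * z\<bar> < 1" by linarith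
  then have "2 ^ n * \<bar>y - z\<bar> < 1" by (simp add: abs_mult flip: right_diff_distrib)
  then show ?thesis by (simp add: field_simps)
qed

text \<open>Termwise comparison with the series of \<open>1/2 ^ Suc n\<close>, whose sum is 1; the
  zero digit makes the upper bound strict.\<close>

lemma binary_expansion_bounds:
  assumes "binary_expansion x y" "x i = 0"
  shows "0 \<le> y" "y < 1"
proof -
  have x: "x n \<in> {0, 1}" for n
    using assms by (auto simp: binary_expansion_def)
  have y: "(\<lambda>n. real (x n) / 2 ^ Suc n) sums y"
    using assms by (auto simp: binary_expansion_def)
  show "0 \<le> y" by (rule sums_le[OF _ sums_zero y]) auto
  have s: "(\<lambda>n. (1/2) ^ Suc n - real (x n) / 2 ^ Suc n) sums (1 - y)"
    by (rule sums_diff[OF power_half_series y])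
  have "0 < (\<Sum>n. (1/2) ^ Suc n - real (x n) / 2 ^ Suc n)"
  proof (rule suminf_pos2)
    show "0 \<le> (1/2) ^ Suc n - real (x n) / 2 ^ Suc n" for n
      using x[of n] by (auto simp: power_divide)
    show "0 < (1/2) ^ Suc i - real (x i) / 2 ^ Suc i" using assms(2) by simp
  qed (use s sums_summable in blast)
  then show "y < 1" using sums_unique[OF s] by simp
qed

text \<open>Shifting the digits is the doubling map, which drives the induction for
  uniqueness.\<close>

lemma binary_expansion_tail:
  assumes "binary_expansion x y"
  shows "binary_expansion (\<lambda>n. x (Suc n)) (2 * y - real (x 0))"
proof -
  have "(\<lambda>n. real (x (Suc n)) / 2 ^ Suc (Suc n)) sums (y - real (x 0) / 2)"
    using assms sums_Suc_imp[of "\<lambda>n. real (x n) / 2 ^ Suc n"]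
    by (subst sums_Suc_iff) (simp add: binary_expansion_def)
  from sums_mult[OF this, of 2] show ?thesis
    using assms by (simp add: binary_expansion_def algebra_simps)
qed

text \<open>Infinitely many zeros put the value of every tail into \<open>[0,1)\<close>. So the
  first digit is \<open>\<lfloor>2 * y\<rfloor>\<close>, and the shift reduces the later digits to
  earlier ones.\<close>

lemma binary_expansion_unique:
  assumes "binary_expansion x y" "\<And>N. \<exists>i\<ge>N. x i = 0"
  shows "x n = bin_digit y n"
  using assms
proof (induction n arbitrary: x y)
  case (0 x y)
  have x0: "x 0 \<in> {0, 1}" using 0 by (auto simp: binary_expansion_def)
  obtain i where "x (Suc i) = 0" using 0(2)[of 1] by (metis Suc_le_D One_nat_def)
  then have "0 \<le> 2 * y - real (x 0)" "2 * y - real (x 0) < 1"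
    using binary_expansion_bounds[OF binary_expansion_tail[OF 0(1)]] by auto
  then have "\<lfloor>2 * y\<rfloor> = int (x 0)" by (simp add: floor_eq_iff)
  then show ?case using x0 by (auto simp: bin_digit_def)
next
  case (Suc n x y)
  have "\<exists>i\<ge>N. x (Suc i) = 0" for N
    using Suc(3)[of "Suc N"] by (metis Suc_le_D Suc_le_mono)
  then have "x (Suc n) = bin_digit (2 * y - real (x 0)) n"
    using Suc.IH[OF binary_expansion_tail[OF Suc(2)]] by blast
  \<comment> \<open>The subtracted integer is even, so the parity of the floor, which is the digit,
    does not change.\<close>
  also have "2 ^ Suc n * (2 * y - real (x 0)) = 2 ^ Suc (Suc n) * y - of_int (2 * (2 ^ n * int (x 0)))"
    by (simp add: algebra_simps)
  then have "bin_digit (2 * y - real (x 0)) n = bin_digit y (Suc n)"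
    unfolding bin_digit_def by (simp only: floor_diff_of_int) (simp add: mod_diff_eq flip: mod_diff_right_eq)
  finally show ?case .
qed

lemma typical_iff:
  assumes "0 \<le> y" "y \<le> 1"
  shows "typical y \<longleftrightarrow> (\<lambda>n. real (longest_run n (bin_digit y)) / log 2 (real n)) \<longlonglongrightarrow> 1"
    (is "_ \<longleftrightarrow> ?lim")
proof
  assume "typical y"
  then obtain x where x: "binary_expansion x y"
    and lim: "(\<lambda>n. real (longest_run n x) / log 2 (real n)) \<longlonglongrightarrow> 1"
    by (auto simp: typical_def)
  have "x = bin_digit y"
    using binary_expansion_unique[OF x] infinitely_many_zeros[OF _ lim] x
    unfolding binary_expansion_def by blast
  then show ?lim using lim by simp
next
  assume lim: ?lim
  \<comment> \<open>At 1 the floor digits all vanish and are no expansion of 1; their ratio tends to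
    0, which contradicts the limit 1.\<close>
  have "y \<noteq> 1"
  proof
    assume "y = 1"
    have "bin_digit 1 n = 0" for n
    proof -
      have "\<lfloor>2 ^ Suc n :: real\<rfloor> = 2 ^ Suc n"
        by (metis floor_of_int of_int_numeral of_int_power)
      then show ?thesis by (simp add: bin_digit_def)
    qed
    then have "longest_run n (bin_digit y) = 0" for n
      using longest_run_le[of n "bin_digit y" 0] \<open>y = 1\<close> by fastforce
    then show False using lim by (simp add: LIMSEQ_const_iff)
  qed
  then show "typical y"
    using binary_expansion_bin_digit lim assms unfolding typical_def by force
qed

text \<open>For irrational \<open>y\<close> no \<open>2 ^ Suc i * y\<close> is an integer, so each
  of the first \<open>n\<close> floors is constant near \<open>y\<close>.\<close>

lemma isCont_longest_run_bin_digit: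
  assumes "y \<notin> \<rat>"
  shows "isCont (\<lambda>z. real (longest_run n (bin_digit z)) / c) y"
proof -
  have "\<forall>\<^sub>F z in nhds y. \<forall>i\<in>{..<n}. bin_digit z i = bin_digit y i"
  proof (rule eventually_ball_finite)
    show "\<forall>i\<in>{..<n}. \<forall>\<^sub>F z in nhds y. bin_digit z i = bin_digit y i"
    proof
      fix i
      have "2 ^ Suc i * y \<notin> \<int>"
      proof
        assume "2 ^ Suc i * y \<in> \<int>"
        then have "(2 ^ Suc i * y) / 2 ^ Suc i \<in> \<rat>" by (intro Rats_divide) (auto elim: Ints_cases)
        then show False using assms by simp
      qed
      then have "\<forall>\<^sub>F z in nhds y. \<lfloor>2 ^ Suc i * z\<rfloor> = \<lfloor>2 ^ Suc i * y\<rfloor>"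
        by (intro eventually_floor_eq tendsto_intros filterlim_ident)
      then show "\<forall>\<^sub>F z in nhds y. bin_digit z i = bin_digit y i"
        by eventually_elim (simp add: bin_digit_def)
    qed
  qed simp
  then have "\<forall>\<^sub>F z in nhds y. real (longest_run n (bin_digit z)) / c = real (longest_run n (bin_digit y)) / c"
    by eventually_elim (metis lessThan_iff longest_run_cong)
  then show ?thesis
    unfolding isCont_def by (intro tendsto_eventually filter_leD[OF at_within_le_nhds])
qed

subsection \<open>Coding sequences by runs\<close>

text \<open>Blocks of ones for different \<open>k\<close> are separated by zeros only if \<open>r k < 2 ^ k\<close>.\<close>

definition block_digit :: "(nat \<Rightarrow> nat) \<Rightarrow> nat \<Rightarrow> nat" where
  "block_digit r i = of_bool (\<exists>k. 2 ^ k < i \<and> i \<le> 2 ^ k + r k)"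

text \<open>Block \<open>k\<close> starts just after \<open>2 ^ k\<close>, and an earlier block
  \<open>j\<close> ends before \<open>2 ^ Suc j \<le> 2 ^ k\<close>.\<close>

lemma block_digit_power_two:
  assumes "\<And>k. r k < 2 ^ k"
  shows "block_digit r (2 ^ k) = 0"
proof -
  have False if "2 ^ j < (2::nat) ^ k" "2 ^ k \<le> 2 ^ j + r j" for j
  proof -
    have "(2::nat) ^ k < 2 ^ Suc j" using that(2) assms[of j] by simp
    then have "k < Suc j" by (rule power_less_imp_less_exp[rotated]) simp
    moreover have "j < k" using that(1) by (rule power_less_imp_less_exp[rotated]) simp
    ultimately show False by simp
  qed
  then show ?thesis by (auto simp: block_digit_def)
qed

lemma longest_run_block_digit_ge:
  assumes "\<And>k. r k < 2 ^ k" "2 ^ Suc k \<le> n"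
  shows "r k \<le> longest_run n (block_digit r)"
proof (rule longest_run_ge[of "2 ^ k + 1"])
  show "2 ^ k + 1 + r k \<le> n" using assms(1)[of k] assms(2) by simp
  show "block_digit r (2 ^ k + 1 + i) = 1" if "i < r k" for i
    using that by (auto simp: block_digit_def intro!: exI[of _ k])
qed

text \<open>A run that starts in block \<open>k\<close> cannot leave it. The position after the
  block would have to lie in some block \<open>l\<close>, and comparing powers of two forces
  \<open>l = k\<close>.\<close>

lemma longest_run_block_digit_le:
  assumes r: "\<And>k. r k < 2 ^ k" and M: "\<And>k. 2 ^ k < n \<Longrightarrow> r k \<le> M"
  shows "longest_run n (block_digit r) \<le> M"
proof (rule longest_run_le)
  fix i j assume ij: "i + j \<le> n" and run: "\<And>k. k < j \<Longrightarrow> block_digit r (i + k) = 1"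
  show "j \<le> M"
  proof (cases "j = 0")
    case False
    then obtain k where k: "2 ^ k < i" "i \<le> 2 ^ k + r k"
      using run[of 0] by (auto simp: block_digit_def of_bool_def split: if_splits)
    have "i + j \<le> 2 ^ k + r k + 1"
    proof (rule ccontr)
      assume "\<not> i + j \<le> 2 ^ k + r k + 1"
      then have "block_digit r (2 ^ k + r k + 1) = 1"
        using run[of "2 ^ k + r k + 1 - i"] k by simp
      then obtain l where l: "2 ^ l < 2 ^ k + r k + 1" "2 ^ k + r k + 1 \<le> 2 ^ l + r l"
        by (auto simp: block_digit_def of_bool_def split: if_splits)
      have "(2::nat) ^ l < 2 ^ Suc k" using l(1) r[of k] by simp
      then have "l < Suc k" by (rule power_less_imp_less_exp[rotated]) simp
      moreover have "(2::nat) ^ k < 2 ^ Suc l" using l(2) r[of l] by simp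
      then have "k < Suc l" by (rule power_less_imp_less_exp[rotated]) simp
      ultimately have "l = k" by simp
      then show False using l(2) by simp
    qed
    then have "j \<le> r k" using k by simp
    then show ?thesis using M[of k] k ij False by linarith
  qed simp
qed

text \<open>The minimum takes effect only for \<open>k < 3\<close>, where the block would not fit otherwise.\<close>

definition block_length :: "(nat \<Rightarrow> nat) \<Rightarrow> nat \<Rightarrow> nat" where
  "block_length a k = min (k + k div Suc (a k)) (2 ^ k - 1)"

lemma block_length_less: "block_length a k < 2 ^ k"
proof -
  have "(0::nat) < 2 ^ k" by simp
  then show ?thesis unfolding block_length_def by linarith
qed

lemma block_length_le: "block_length a k \<le> k + k div Suc (a k)"
  by (simp add: block_length_def)

lemma block_length_ge: "k \<le> block_length a k"
proof -
  have "k < 2 ^ k" by (rule less_exp)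
  then show ?thesis unfolding block_length_def by linarith
qed

lemma block_length_eq:
  assumes "3 \<le> k"
  shows "block_length a k = k + k div Suc (a k)"
proof -
  have "2 * k < 2 ^ k" using assms by (induction k rule: dec_induct) auto
  moreover have "k div Suc (a k) \<le> k" by (rule div_le_dividend)
  ultimately show ?thesis unfolding block_length_def by linarith
qed

section \<open>Run lengths of the code against divergence of the sequence\<close>

text \<open>For \<open>2 ^ k \<le> n < 2 ^ Suc k\<close> the longest run lies between
  \<open>k - 1\<close> and \<open>k + k div m\<close>, where \<open>m\<close> is an eventual lower
  bound of \<open>a\<close>.\<close>

lemma block_length_ratio_tendsto_1:
  assumes "filterlim a at_top sequentially"
  shows "(\<lambda>n. real (longest_run n (block_digit (block_length a))) / log 2 (real n)) \<longlonglongrightarrow> 1"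
proof (rule LIMSEQ_I)
  fix e :: real assume e: "0 < e"
  obtain m' where m': "inverse (real (Suc m')) < e" using reals_Archimedean e by blast
  define m where "m = Suc m'"
  have m: "0 < m" "1 / real m < e" using m' by (simp_all add: m_def inverse_eq_divide)
  obtain J where J: "\<And>j. J \<le> j \<Longrightarrow> m \<le> a j"
    using assms unfolding filterlim_at_top eventually_sequentially by blast
  \<comment> \<open>The first bound covers blocks \<open>j < J\<close>, whose length is at most
    \<open>2 * j \<le> k\<close>. The second makes \<open>e * log 2 n\<close> exceed the loss of 2
    in the lower estimate.\<close>
  define K where "K = max (2 * J + 1) (nat \<lceil>2 / e\<rceil> + 1)"
  have K: "1 \<le> K" "2 * J \<le> K" "2 / e < K" unfolding K_def by linarith+
  have "\<bar>real (longest_run n (block_digit (block_length a))) / log 2 (real n) - 1\<bar> < e"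
    if n: "2 ^ K \<le> n" for n
  proof -
    define L where "L = longest_run n (block_digit (block_length a))"
    have "1 \<le> n" using n by (meson le_trans one_le_numeral one_le_power)
    then obtain k where k: "2 ^ k \<le> n" "n < 2 ^ (k + 1)"
      using ex_power_ivl1[of 2 n] by auto
    have "(2::nat) ^ K < 2 ^ Suc k" using n k by simp
    then have "K < Suc k" by (rule power_less_imp_less_exp[rotated]) simp
    then have Kk: "K \<le> k" by simp
    have log: "real k \<le> log 2 n" "log 2 n < real k + 1"
      using le_log2_of_power[OF k(1)] log2_of_power_less[OF k(2)] \<open>1 \<le> n\<close> by simp_all
    have "L \<le> k + k div m"
      unfolding L_def
    proof (rule longest_run_block_digit_le[OF block_length_less])
      fix j assume "2 ^ j < n"
      then have "(2::nat) ^ j < 2 ^ Suc k" using k by simp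
      then have "j < Suc k" by (rule power_less_imp_less_exp[rotated]) simp
      then have j: "j \<le> k" by simp
      show "block_length a j \<le> k + k div m"
      proof (cases "J \<le> j")
        case True
        have "j div Suc (a j) \<le> j div m"
          using J[OF True] m by (intro div_le_mono2) auto
        also have "\<dots> \<le> k div m" using j by (rule div_le_mono)
        finally show ?thesis using block_length_le[of a j] j by linarith
      next
        case False
        have "j div Suc (a j) \<le> j" by (rule div_le_dividend)
        then show ?thesis using block_length_le[of a j] False K(2) Kk by linarith
      qed
    qed
    then have "real L \<le> real k + real (k div m)" by linarith
    moreover have "real (k div m) \<le> real k / real m" by (rule of_nat_div_le_of_nat)
    ultimately have "real L \<le> real k + real k / real m" by linarith
    also have "real k + real k / real m = real k * (1 + 1 / m)" by (simp add: distrib_left)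
    also have "\<dots> < real k * (1 + e)" using m Kk K by (intro mult_strict_left_mono) auto
    also have "\<dots> \<le> log 2 n * (1 + e)" using log e by (intro mult_right_mono) auto
    finally have upper: "real L < log 2 n * (1 + e)" .
    obtain k' where k': "k = Suc k'" using Kk K by (cases k) auto
    \<comment> \<open>Block \<open>k\<close> may be cut off at \<open>n\<close>, so the complete
      block \<open>k - 1\<close> is used.\<close>
    have "k' \<le> L"
      using longest_run_block_digit_ge[of "block_length a" k' n, OF block_length_less]
        block_length_ge[of k' a] k k' by (simp add: L_def)
    then have "log 2 n - 2 < real L" using log k' by simp
    moreover have "2 < e * log 2 n"
    proof -
      have "2 / e < log 2 n" using K(3) Kk log by linarith
      then show ?thesis using e by (simp add: field_simps)
    qed
    ultimately have lower: "log 2 n * (1 - e) < real L" by (simp add: algebra_simps)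
    have pos: "0 < log 2 n" using log K Kk by linarith
    show ?thesis
      using upper lower pos by (simp add: abs_less_iff field_simps flip: L_def)
  qed
  then show "\<exists>no. \<forall>n\<ge>no. norm (real (longest_run n (block_digit (block_length a))) / log 2 (real n) - 1) < e"
    by auto
qed

text \<open>If \<open>a k < m\<close> infinitely often, then at \<open>n = 2 ^ Suc k\<close> the
  ratio is near \<open>1 + 1/m\<close> or above for large such \<open>k\<close>, outside the
  tolerance \<open>1 / (2 * m)\<close>.\<close>

lemma block_length_ratio_tendsto_1D:
  assumes "(\<lambda>n. real (longest_run n (block_digit (block_length a))) / log 2 (real n)) \<longlonglongrightarrow> 1"
  shows "filterlim a at_top sequentially"
proof (rule ccontr)
  assume "\<not> filterlim a at_top sequentially"
  then obtain m where inf: "\<And>N. \<exists>k\<ge>N. a k < m"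
    unfolding filterlim_at_top eventually_sequentially by (metis linorder_not_less)
  have m: "0 < m" using inf[of 0] by auto
  obtain N where N: "\<And>n. N \<le> n \<Longrightarrow>
      norm (real (longest_run n (block_digit (block_length a))) / log 2 (real n) - 1) < 1 / (2 * m)"
    using LIMSEQ_D[OF assms, of "1 / (2 * m)"] m by auto
  \<comment> \<open>\<open>N\<close> puts \<open>2 ^ Suc k\<close> in the range of the estimate, 3
    removes the minimum in \<open>block_length\<close>, and \<open>4 * m\<close> contradicts the
    final bound \<open>k < 4 * m + 1\<close>.\<close>
  obtain k where k: "N + 4 * m + 3 \<le> k" "a k < m" using inf by blast
  define L where "L = longest_run (2 ^ Suc k) (block_digit (block_length a))"
  have "k div m \<le> k div Suc (a k)" using k by (intro div_le_mono2) auto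
  then have "k + k div m \<le> L"
    using longest_run_block_digit_ge[of "block_length a" k "2 ^ Suc k", OF block_length_less]
      block_length_eq[of k a] k by (simp add: L_def)
  moreover have "real k / real m - 1 < real (k div m)"
    by (metis floor_divide_of_nat_eq of_int_of_nat_eq real_of_int_floor_gt_diff_one)
  ultimately have lower: "real k + real k / real m - 1 < real L" by linarith
  have "k < 2 ^ k" by (rule less_exp)
  then have "N \<le> 2 ^ Suc k" using k unfolding power_Suc by linarith
  moreover have "log 2 (real (2 ^ Suc k)) = real k + 1"
    using log_pow_cancel[of 2 "Suc k"] by simp
  ultimately have "real L / (real k + 1) - 1 < 1 / (2 * m)"
    using N[of "2 ^ Suc k"] unfolding L_def by (simp add: abs_less_iff)
  then have "real L < (1 + 1 / (2 * m)) * (real k + 1)" by (simp add: field_simps)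
  with lower have "real k / m - 2 < (real k + 1) / (2 * m)" by (simp add: field_simps)
  then have "real k * m < (4 * m + 1) * m" using m by (simp add: field_simps)
  then have "k < 4 * m + 1" using mult_less_cancel2 by (metis of_nat_less_iff of_nat_mult)
  then show False using k by linarith
qed

section \<open>The coding map into the unit interval\<close>

definition block_real :: "(nat \<Rightarrow> nat) \<Rightarrow> real" where
  "block_real a = (\<Sum>n. real (block_digit (block_length a) n) / 2 ^ Suc n)"

lemma binary_expansion_block_real: "binary_expansion (block_digit (block_length a)) (block_real a)"
proof -
  have "summable (\<lambda>n. real (block_digit (block_length a) n) / 2 ^ Suc n)"
    by (rule summable_comparison_test'[OF sums_summable[OF power_half_series]])
      (auto simp: block_digit_def power_divide)
  then show ?thesis
    by (auto simp: binary_expansion_def block_real_def block_digit_def summable_sums)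
qed

lemma block_digit_block_length_zero: "\<exists>i\<ge>N. block_digit (block_length a) i = 0"
  using block_digit_power_two[of "block_length a" N, OF block_length_less] less_imp_le[OF less_exp[of N]]
  by (intro exI[of _ "2 ^ N"] conjI)

lemma block_real_bounds: "0 \<le> block_real a" "block_real a < 1"
  using binary_expansion_bounds[OF binary_expansion_block_real] block_digit_block_length_zero by blast+

lemma bin_digit_block_real: "bin_digit (block_real a) = block_digit (block_length a)"
  using binary_expansion_unique[OF binary_expansion_block_real block_digit_block_length_zero] by fastforce

lemma block_real_in_TpcN_iff: "block_real a \<in> TpcN \<longleftrightarrow> filterlim a at_top sequentially"
  using block_real_bounds[of a] block_length_ratio_tendsto_1 block_length_ratio_tendsto_1D
  by (auto simp: TpcN_def typical_iff bin_digit_block_real)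

text \<open>Position \<open>i < N\<close> can lie in block \<open>k\<close> only if
  \<open>2 ^ k < i\<close>, hence \<open>k < N\<close>. So the first \<open>N\<close> digits depend
  only on the first \<open>N\<close> entries.\<close>

lemma block_real_cylinder:
  assumes "b \<in> cylinder a N"
  shows "\<bar>block_real a - block_real b\<bar> < 1 / 2 ^ N"
proof (rule bin_digit_agree_dist)
  fix i assume i: "i < N"
  have "block_length a k = block_length b k" if "2 ^ k < i" for k
  proof -
    have "k < N" using less_exp[of k] that i by linarith
    then show ?thesis using assms by (simp add: cylinder_def block_length_def)
  qed
  then show "bin_digit (block_real a) i = bin_digit (block_real b) i"
    by (auto simp: bin_digit_block_real block_digit_def)
qed (rule block_real_bounds)+

lemma cylinder_open_block_real_vimage:
  assumes "openin (top_of_set {0..1}) V"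
  shows "cylinder_open (block_real -` V)"
  unfolding cylinder_open_def
proof
  fix a assume a: "a \<in> block_real -` V"
  obtain T where T: "open T" "V = {0..1} \<inter> T" using assms by (auto simp: openin_open)
  then obtain e where e: "0 < e" "ball (block_real a) e \<subseteq> T"
    using a open_contains_ball by (metis IntD2 vimageE)
  obtain N where N: "(1 / 2) ^ N < e" using real_arch_pow_inv[OF e(1), of "1 / 2"] by auto
  have "block_real b \<in> V" if "b \<in> cylinder a N" for b
  proof -
    have "dist (block_real a) (block_real b) < e"
      using block_real_cylinder[OF that] N by (simp add: dist_real_def power_divide)
    then show ?thesis
      using e T block_real_bounds[of b] by auto
  qed
  then show "\<exists>N. cylinder a N \<subseteq> block_real -` V" by blast
qed

section \<open>Exact Borel level of the typical numbers\<close>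

lemma Pi0_3_TpcN: "Pi0 (top_of_set {0..1}) 3 TpcN"
proof -
  have eq: "TpcN = {y \<in> {0..1}. (\<lambda>n. real (longest_run n (bin_digit y)) / log 2 (real n)) \<longlonglongrightarrow> 1}"
    by (auto simp: TpcN_def typical_iff)
  show ?thesis
    unfolding eq by (intro Pi0_3_convergence_set[OF countable_rat] isCont_longest_run_bin_digit, simp)
qed

text \<open>Preimages under \<open>block_real\<close> commute with unions and intersections, so a
  union of \<open>G_delta\<close> sets equal to \<open>TpcN\<close> would pull back to one equal to
  the set of diverging sequences.\<close>

lemma not_Sigma0_3_TpcN: "\<not> Sigma0 (top_of_set {0..1}) 3 TpcN"
proof
  assume *: "Sigma0 (top_of_set {0..1}) 3 TpcN"
  have "metrizable_space (top_of_set {0..1::real})"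
    by (simp add: metrizable_space_euclidean metrizable_space_subtopology)
  then obtain G where G: "\<And>n::nat. gdelta_in (top_of_set {0..1}) (G n)" "TpcN = (\<Union>n. G n)"
    using Sigma0_3_gdelta_sigma * by metis
  have "\<exists>V. (\<forall>k. openin (top_of_set {0..1}) (V k)) \<and> (\<Inter>k::nat. V k) = G n" for n
    using G(1)[of n] unfolding gdelta_in_descending by blast
  then obtain V where V: "\<And>n k. openin (top_of_set {0..1}) (V n k)" "\<And>n. (\<Inter>k::nat. V n k) = G n"
    by metis
  have "(\<Union>n. \<Inter>k. block_real -` V n k) = block_real -` TpcN"
    unfolding G(2) V(2)[symmetric] by auto
  also have "\<dots> = {a. filterlim a at_top sequentially}"
    by (auto simp: block_real_in_TpcN_iff)
  finally have "(\<Union>n. \<Inter>k. block_real -` V n k) = {a. filterlim a at_top sequentially}" .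
  moreover have "cylinder_open (block_real -` V n k)" for n k
    by (rule cylinder_open_block_real_vimage[OF V(1)])
  ultimately show False
    using diverging_sequences_not_gdelta_sigma[of "\<lambda>n k. block_real -` V n k"] by simp
qed

theorem theoremA:
  "TpcN \<in> sets (restrict_space borel {0..1}) \<and> Pi0_3_complete (top_of_set {0..1}) TpcN"
  using Pi0_3_TpcN not_Sigma0_3_TpcN Borel_hierarchy_sets_restrict_borel(2)
  unfolding Pi0_3_complete_def by blast

end
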